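(* Let $a,b,c,d,\lambda$ be real numbers with $\lambda\neq 0$, let $n\ge 0$ be an integer, and put $$\alpha_n=-\frac{\lambda}{4}\,n\big(2c+(\lambda n-2)a\big),\qquad \beta=-\frac{\lambda}{4}\big(2d+(\lambda-2)b\big).$$ Assume that the denominators in the following formula are nonzero. Then the function $$y(x)=\sum_{k=0}^{[n/2]}\binom{[n/2]}{k}\Bigg(\prod_{i=0}^{[n/2]-(k+1)}\frac{\big(2i+(-1)^{n+1}+2[n/2]+1-\frac{2}{\lambda}\big)a+\frac{2c}{\lambda}}{\big(2i+(-1)^{n+1}+3-\frac{2}{\lambda}\big)b+\frac{2d}{\lambda}}\Bigg)x^{(n-2k)\frac{\lambda}{2}}$$ is a solution of the differential equation $$x^2(ax^{\lambda}+b)\,y''+x(cx^{\lambda}+d)\,y'+\Big(\alpha_n x^{\lambda}+\beta\,\frac{1-(-1)^n}{2}\Big)y=0 .$$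
   Context: $[\cdot]$ denotes the integer part, and empty products equal $1$. Real powers $x^{\lambda}$ and $x^{\lambda/2}$ are understood at points where they are defined (for instance $x>0$). *)

theory Defs
  imports Complex_Main
begin

text \<open>
  Real powers \<open>x\<^sup>r\<close> of a real base.  For \<open>x < 0\<close> the power is defined exactly when \<open>r\<close> is a
  rational number \<open>p/q\<close> with odd denominator, and then it is the \<open>p\<close>-th power of the (real) \<open>q\<close>-th
  root of \<open>x\<close>; see lemma \<open>rpow_eq_root_powi\<close>.  At \<open>x = 0\<close> it is defined for \<open>r \<ge> 0\<close>, with
  \<open>0\<^sup>0 = 1\<close>, so that \<open>x\<^sup>0\<close> is the constant function 1.  (The library's \<open>powr\<close> has other values at
  \<open>x \<le> 0\<close>.)
\<close>

definition odd_denominator :: "real \<Rightarrow> bool" where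
  "odd_denominator r \<longleftrightarrow> (\<exists>p q :: int. odd q \<and> r = of_int p / of_int q)"

definition rpow_defined :: "real \<Rightarrow> real \<Rightarrow> bool" where
  "rpow_defined x r \<longleftrightarrow> x > 0 \<or> (x < 0 \<and> odd_denominator r) \<or> (x = 0 \<and> r \<ge> 0)"

definition rpow :: "real \<Rightarrow> real \<Rightarrow> real" where
  "rpow x r =
    (if x > 0 then x powr r
     else if x < 0 then
       (if \<exists>p q :: int. odd p \<and> odd q \<and> r = of_int p / of_int q
        then - ((- x) powr r) else (- x) powr r)
     else (if r = 0 then 1 else 0))"

lemma rpow_eq_root_powi:
  assumes "odd q" and "rpow_defined x (of_int p / of_nat q)"
  shows "rpow x (of_int p / of_nat q) = root q x powi p"
proof -
  have q: "q > 0" using assms(1) by (rule odd_pos)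
  have pos: "u powr (of_int p / of_nat q) = root q u powi p" if "u > 0" for u :: real
  proof -
    have "root q u powi p = (u powr (1 / of_nat q)) powr of_int p"
      using that q by (simp add: root_powr_inverse powr_real_of_int')
    then show ?thesis by (simp add: powr_powr)
  qed
  have parity: "(\<exists>p' q' :: int. odd p' \<and> odd q' \<and> of_int p / of_nat q = (of_int p' / of_int q' :: real))
                 \<longleftrightarrow> odd p"
  proof
    assume "\<exists>p' q' :: int. odd p' \<and> odd q' \<and> of_int p / of_nat q = (of_int p' / of_int q' :: real)"
    then obtain p' q' :: int where *: "odd p'" "odd q'"
      "of_int p / of_nat q = (of_int p' / of_int q' :: real)" by blast
    have "q' \<noteq> 0" using *(2) by auto
    then have "real_of_int p * real_of_int q' = real_of_int p' * real q"
      using *(3) q by (simp add: frac_eq_eq)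
    then have "real_of_int (p * q') = real_of_int (p' * int q)" by simp
    then have "p * q' = p' * int q" by (simp only: of_int_eq_iff)
    then have "odd (p * q')" using *(1) assms(1) by simp
    then show "odd p" by simp
  next
    assume "odd p"
    then show "\<exists>p' q' :: int. odd p' \<and> odd q' \<and> of_int p / of_nat q = (of_int p' / of_int q' :: real)"
      using assms(1) by (intro exI[of _ p] exI[of _ "int q"]) simp
  qed
  consider "x > 0" | "x < 0" | "x = 0" by linarith
  then show ?thesis
  proof cases
    case 1
    then show ?thesis by (simp add: rpow_def pos)
  next
    case 2
    have "root q x = - root q (- x)" by (simp add: real_root_minus)
    then have "root q x powi p = (if even p then root q (- x) powi p else - (root q (- x) powi p))"
      by (simp add: power_int_minus_left)
    then show ?thesis using 2 pos[of "- x"] unfolding rpow_def parity by auto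
  next
    case 3
    then have "p \<ge> 0" using assms(2) q by (auto simp: rpow_defined_def field_simps)
    then show ?thesis using 3 q by (auto simp: rpow_def power_int_def)
  qed
qed

text \<open>
  The points where the powers \<open>x\<^bsup>lam\<^esup>\<close> and \<open>x\<^sup>e\<close> with \<open>e = (n - 2k) * lam / 2\<close>,
  \<open>0 \<le> k \<le> [n/2]\<close>, are all defined.  At \<open>x = 0\<close> a power \<open>x\<^sup>e\<close> with \<open>0 < e < 1\<close> or
  \<open>1 < e < 2\<close> is not twice differentiable, so 0 is excluded if such an \<open>e\<close> occurs.
  The set is one of \<open>{0<..}\<close>, \<open>{0..}\<close>, \<open>\<real> - {0}\<close> and \<open>\<real>\<close>, so that a derivative within it
  is the ordinary one (one-sided at the end point of \<open>{0..}\<close>).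
\<close>

definition solution_domain :: "real \<Rightarrow> nat \<Rightarrow> real set" where
  "solution_domain lam n =
    {x. rpow_defined x lam \<and>
        (\<forall>k \<le> n div 2. (let e = (real n - 2 * real k) * lam / 2 in
           rpow_defined x e \<and> (x = 0 \<longrightarrow> e = 0 \<or> e = 1 \<or> e \<ge> 2)))}"

end

theory Submission
  imports Defs
begin

text \<open>
  Put \<open>m = [n/2]\<close>, \<open>n = 2m + \<epsilon>\<close> and \<open>j = m - k\<close>, so that \<open>y = \<Sum>j\<le>m. A j * x\<^bsup>e j\<^esup>\<close> with
  \<open>e j = (2j + \<epsilon>) lam / 2\<close>.  On \<open>x\<^sup>e\<close> the differential operator acts as
  \<open>P e * x\<^bsup>e + lam\<^esup> + Q e * x\<^sup>e\<close> with quadratic polynomials \<open>P\<close> and \<open>Q\<close>, and \<open>\<alpha>\<close>, \<open>\<beta>\<close> are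
  chosen such that \<open>P (e m) = 0\<close> and \<open>Q (e 0) = 0\<close>.  Since \<open>e j + lam = e (j + 1)\<close>, all terms
  cancel by the two-term recurrence \<open>A j * P (e j) + A (j + 1) * Q (e (j + 1)) = 0\<close>, which is
  the ratio of consecutive factors in the product formula for the coefficients.
\<close>

section \<open>Algebra of real powers\<close>

lemma abs_rpow: "x \<noteq> 0 \<Longrightarrow> \<bar>rpow x r\<bar> = \<bar>x\<bar> powr r"
  by (auto simp: rpow_def)

lemma rpow_0_right [simp]: "rpow x 0 = 1"
  by (auto simp: rpow_def)

lemma rpow_1_right [simp]: "rpow x 1 = x"
proof -
  have "\<exists>p q :: int. odd p \<and> odd q \<and> (1::real) = of_int p / of_int q"
    by (intro exI[of _ 1]) simp
  then show ?thesis by (auto simp: rpow_def)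
qed

text \<open>Over one odd denominator \<open>q\<close>, both powers of a negative base become integer
  powers of the same real root \<open>root q x\<close>.\<close>

lemma odd_denominator_common:
  assumes "odd_denominator r" "odd_denominator s"
  obtains p p' :: int and q :: nat
  where "odd q" "r = of_int p / of_nat q" "s = of_int p' / of_nat q"
proof -
  from assms obtain u v u' v' :: int where uv: "odd v" "r = of_int u / of_int v"
    "odd v'" "s = of_int u' / of_int v'" by (auto simp: odd_denominator_def)
  have [simp]: "v \<noteq> 0" "v' \<noteq> 0" using uv by auto
  \<comment> \<open>The root is indexed by a natural number, so the sign of the common denominator
    \<open>v * v'\<close> is moved into the numerators.\<close>
  define w where "w = sgn (v * v')"
  have w: "w * (v * v') = \<bar>v * v'\<bar>" "w \<noteq> 0"
    by (simp_all add: w_def abs_sgn mult.commute sgn_0_0)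
  have q: "real (nat \<bar>v * v'\<bar>) = real_of_int (w * (v * v'))"
    by (simp add: w(1))
  show ?thesis
  proof (rule that)
    show "odd (nat \<bar>v * v'\<bar>)" using uv by (simp add: even_nat_iff)
    show "r = of_int (w * u * v') / of_nat (nat \<bar>v * v'\<bar>)"
      unfolding q using w(2) by (simp add: uv)
    show "s = of_int (w * u' * v) / of_nat (nat \<bar>v * v'\<bar>)"
      unfolding q using w(2) by (simp add: uv)
  qed
qed

text \<open>For negative \<open>x\<close> this is the power law for integer exponents of
  \<open>root q x\<close>. Definedness matters: at \<open>x = -1\<close> with
  \<open>r = s = 1/2\<close> the left side is -1 and the right side 1, and at \<open>x = 0\<close>
  opposite nonzero exponents would give 1 and 0.\<close>

lemma rpow_add:
  assumes "rpow_defined x r" "rpow_defined x s"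
  shows "rpow x (r + s) = rpow x r * rpow x s"
proof -
  consider "x > 0" | "x < 0" | "x = 0" by linarith
  then show ?thesis
  proof cases
    case 1
    then show ?thesis by (simp add: rpow_def powr_add)
  next
    case 2
    then have "odd_denominator r" "odd_denominator s" using assms by (auto simp: rpow_defined_def)
    then obtain p p' :: int and q :: nat
      where *: "odd q" "r = of_int p / of_nat q" "s = of_int p' / of_nat q"
      by (rule odd_denominator_common)
    have q: "q > 0" using *(1) by (rule odd_pos)
    have def: "rpow_defined x (of_int t / of_nat q)" for t :: int
    proof -
      have "odd_denominator (of_int t / of_nat q)"
        unfolding odd_denominator_def using *(1) by (intro exI[of _ t] exI[of _ "int q"]) simp
      then show ?thesis using 2 by (simp add: rpow_defined_def)
    qed
    have "r + s = of_int (p + p') / of_nat q" by (simp add: * add_divide_distrib)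
    moreover have "root q x \<noteq> 0" using 2 q by simp
    ultimately show ?thesis
      by (simp add: *(2,3) rpow_eq_root_powi[OF *(1) def] power_int_add del: of_int_add)
  next
    case 3
    then show ?thesis using assms by (auto simp: rpow_def rpow_defined_def)
  qed
qed

lemma rpow_2_right [simp]: "rpow x 2 = x\<^sup>2"
proof -
  have "rpow_defined x 1"
    by (auto simp: rpow_defined_def odd_denominator_def intro!: exI[of _ 1])
  from rpow_add[OF this this] show ?thesis by (simp add: power2_eq_square)
qed

section \<open>Derivatives of real powers\<close>

lemma has_real_derivative_rpow_nonzero:
  assumes "x \<noteq> 0"
  shows "((\<lambda>x. rpow x r) has_real_derivative r * rpow x r / x) (at x)"
proof (cases "x > 0")
  case True
  have "((\<lambda>x. x powr r) has_real_derivative r * rpow x r / x) (at x)"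
    using True by (auto intro!: derivative_eq_intros simp: rpow_def powr_diff)
  then show ?thesis
    by (rule has_field_derivative_transform_within_open[where S = "{0<..}"])
      (use True in \<open>auto simp: rpow_def\<close>)
next
  case False
  \<comment> \<open>The sign depends on \<open>r\<close> alone, so on the whole negative half-line
    \<open>rpow\<close> is a constant multiple of \<open>(- z) powr r\<close>.\<close>
  define \<sigma> :: real where
    "\<sigma> = (if \<exists>p q :: int. odd p \<and> odd q \<and> r = of_int p / of_int q then - 1 else 1)"
  have eq: "rpow z r = \<sigma> * (- z) powr r" if "z < 0" for z
    using that by (simp add: rpow_def \<sigma>_def)
  have "((\<lambda>x. \<sigma> * (- x) powr r) has_real_derivative r * rpow x r / x) (at x)"
    using False assms by (auto intro!: derivative_eq_intros simp: eq powr_diff)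
  then show ?thesis
    by (rule has_field_derivative_transform_within_open[where S = "{..<0}"])
      (use False assms in \<open>auto simp: eq\<close>)
qed

text \<open>The difference quotient at 0 is at most \<open>C * \<bar>h\<bar> powr (r - 1)\<close>,
  which tends to 0 as \<open>r > 1\<close>. This serves both a power and its first derivative at
  0.\<close>

lemma has_real_derivative_0_powr_bound:
  fixes g :: "real \<Rightarrow> real"
  assumes "r > 1" "g 0 = 0" "\<And>x. x \<noteq> 0 \<Longrightarrow> \<bar>g x\<bar> \<le> C * \<bar>x\<bar> powr r"
  shows "(g has_real_derivative 0) (at 0)"
proof -
  have "((\<lambda>h. C * \<bar>h\<bar> powr (r - 1)) \<longlongrightarrow> C * \<bar>0\<bar> powr (r - 1)) (at (0::real))"
    using assms(1) by (intro tendsto_intros tendsto_powr') auto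
  then have lim: "((\<lambda>h. C * \<bar>h\<bar> powr (r - 1)) \<longlongrightarrow> 0) (at (0::real))"
    using assms(1) by simp
  have "((\<lambda>h. g h / h) \<longlongrightarrow> 0) (at 0)"
  proof (rule tendsto_0_le[OF lim, where K = 1])
    have "\<bar>g h / h\<bar> \<le> C * \<bar>h\<bar> powr (r - 1)" if "h \<noteq> 0" for h
      using divide_right_mono[OF assms(3)[OF that], of "\<bar>h\<bar>"] that by (simp add: powr_diff)
    then show "\<forall>\<^sub>F h in at 0. norm (g h / h) \<le> norm (C * \<bar>h\<bar> powr (r - 1)) * 1"
      unfolding eventually_at_filter by (intro always_eventually) (smt (verit) real_norm_def)
  qed
  then show ?thesis by (simp add: has_field_derivative_iff assms(2))
qed

text \<open>At \<open>x = 0\<close> the quotients below are 0 since \<open>u / 0 = 0\<close>; for the exponents \<open>r = 0\<close>,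
  \<open>r = 1\<close>, \<open>r \<ge> 2\<close> this is the right value except in the two special cases.\<close>

definition rpow_deriv :: "real \<Rightarrow> real \<Rightarrow> real" where
  "rpow_deriv r x = (if r = 1 then 1 else r * rpow x r / x)"

definition rpow_deriv2 :: "real \<Rightarrow> real \<Rightarrow> real" where
  "rpow_deriv2 r x = (if r = 2 then 2 else r * (r - 1) * rpow x r / x\<^sup>2)"

lemma has_real_derivative_rpow:
  assumes "x = 0 \<longrightarrow> r = 0 \<or> r = 1 \<or> r \<ge> 2"
  shows "((\<lambda>x. rpow x r) has_real_derivative rpow_deriv r x) (at x)"
proof (cases "x = 0")
  case False
  then show ?thesis using has_real_derivative_rpow_nonzero[of x r] by (simp add: rpow_deriv_def)
next
  case True
  consider "r = 0" | "r = 1" | "r \<ge> 2" using assms True by auto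
  then show ?thesis
  proof cases
    case 3
    have "((\<lambda>x. rpow x r) has_real_derivative 0) (at 0)"
      by (rule has_real_derivative_0_powr_bound[where r = r and C = 1])
        (use 3 in \<open>auto simp: abs_rpow rpow_def\<close>)
    then show ?thesis using 3 True by (simp add: rpow_deriv_def)
  qed (auto simp: rpow_deriv_def)
qed

lemma has_real_derivative_rpow_deriv:
  assumes "x = 0 \<longrightarrow> r = 0 \<or> r = 1 \<or> r \<ge> 2"
  shows "(rpow_deriv r has_real_derivative rpow_deriv2 r x) (at x)"
proof -
  \<comment> \<open>The exponent 2 needs its own case: its first derivative \<open>2 * x\<close> is
    only of order 1 at 0, while the bound above requires order \<open>r - 1 > 1\<close>.\<close>
  consider "r = 0" | "r = 1" | "r = 2" | "r \<noteq> 0" "r \<noteq> 1" "r \<noteq> 2" "x \<noteq> 0" | "r > 2" "x = 0"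
    using assms by fastforce
  then show ?thesis
  proof cases
    case 3
    then have "rpow_deriv r = (\<lambda>x. 2 * x)"
      by (auto simp: rpow_deriv_def power2_eq_square)
    then show ?thesis using 3
      by (auto intro!: derivative_eq_intros simp: rpow_deriv2_def)
  next
    case 4
    then have "((\<lambda>x. r * rpow x r / x) has_real_derivative rpow_deriv2 r x) (at x)"
      by (auto intro!: derivative_eq_intros has_real_derivative_rpow_nonzero
          simp: rpow_deriv2_def field_simps power2_eq_square)
    then show ?thesis using 4 by (simp add: rpow_deriv_def[abs_def])
  next
    case 5
    have "(rpow_deriv r has_real_derivative 0) (at 0)"
    proof (rule has_real_derivative_0_powr_bound[where r = "r - 1" and C = r])
      show "\<bar>rpow_deriv r x\<bar> \<le> r * \<bar>x\<bar> powr (r - 1)" if "x \<noteq> 0" for x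
        using 5 that by (simp add: rpow_deriv_def abs_mult abs_rpow powr_diff)
    qed (use 5 in \<open>auto simp: rpow_deriv_def\<close>)
    then show ?thesis using 5 by (simp add: rpow_deriv2_def)
  qed (auto simp: rpow_deriv_def[abs_def] rpow_deriv2_def)
qed

text \<open>Multiplying by \<open>x\<close> undoes the division in the derivative. At
  \<open>x = 0\<close> the right side vanishes as well, through the factor \<open>r\<close> or
  through \<open>rpow 0 r\<close>.\<close>

lemma mult_rpow_deriv:
  assumes "x = 0 \<longrightarrow> r \<ge> 0"
  shows "x * rpow_deriv r x = r * rpow x r"
proof (cases "r = 1")
  case False
  then show ?thesis using assms by (cases "x = 0") (auto simp: rpow_deriv_def rpow_def[of 0])
qed (simp add: rpow_deriv_def)

lemma power2_mult_rpow_deriv2: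
  assumes "x = 0 \<longrightarrow> r \<ge> 0"
  shows "x\<^sup>2 * rpow_deriv2 r x = r * (r - 1) * rpow x r"
proof (cases "r = 2")
  case False
  then show ?thesis using assms by (cases "x = 0") (auto simp: rpow_deriv2_def rpow_def[of 0])
qed (simp add: rpow_deriv2_def)

section \<open>Cancellation and the differential equation\<close>

text \<open>Multiplication by \<open>X\<close> moves the \<open>P\<close>-part up by one index,
  where it meets the \<open>Q\<close>-part; \<open>P m = 0\<close> and \<open>Q 0 = 0\<close> remove
  the two end terms without a partner. In the application \<open>X\<close> is the power with
  exponent \<open>lam\<close> and \<open>p j\<close> the one with exponent
  \<open>e j\<close>.\<close>

lemma two_term_recurrence_sum_eq_0:
  fixes A P Q p :: "nat \<Rightarrow> real"
  assumes "P m = 0" "Q 0 = 0"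
    and "\<And>j. j < m \<Longrightarrow> X * p j = p (Suc j)"
    and "\<And>j. j < m \<Longrightarrow> A j * P j + A (Suc j) * Q (Suc j) = 0"
  shows "(\<Sum>j\<le>m. A j * (P j * X + Q j) * p j) = 0"
proof -
  have "(\<Sum>j\<le>m. A j * (P j * X + Q j) * p j) =
      (\<Sum>j\<le>m. A j * P j * (X * p j)) + (\<Sum>j\<le>m. A j * Q j * p j)"
    by (simp add: algebra_simps sum.distrib)
  also have "(\<Sum>j\<le>m. A j * P j * (X * p j)) = (\<Sum>j<m. A j * P j * (X * p j))"
    by (simp add: assms(1) lessThan_Suc_atMost[symmetric])
  also have "\<dots> = (\<Sum>j<m. A j * P j * p (Suc j))"
    by (simp add: assms(3))
  also have "(\<Sum>j\<le>m. A j * Q j * p j) = (\<Sum>j<m. A (Suc j) * Q (Suc j) * p (Suc j))"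
    by (simp add: assms(2) sum.lessThan_Suc_shift lessThan_Suc_atMost[symmetric] del: sum.lessThan_Suc)
  also have "(\<Sum>j<m. A j * P j * p (Suc j)) + (\<Sum>j<m. A (Suc j) * Q (Suc j) * p (Suc j)) =
      (\<Sum>j<m. (A j * P j + A (Suc j) * Q (Suc j)) * p (Suc j))"
    by (simp add: algebra_simps sum.distrib)
  also have "\<dots> = 0" by (simp add: assms(4))
  finally show ?thesis .
qed

theorem mainTheorem3:
  fixes a b c d lam \<alpha> \<beta> :: real and n :: nat and y :: "real \<Rightarrow> real"
  assumes "lam \<noteq> 0"
    and "\<alpha> = - (lam / 4) * real n * (2 * c + (lam * real n - 2) * a)"
    and "\<beta> = - (lam / 4) * (2 * d + (lam - 2) * b)"
    and "\<And>i. i < n div 2 \<Longrightarrow>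
           (2 * real i + (-1) ^ (n + 1) + 3 - 2 / lam) * b + 2 * d / lam \<noteq> 0"
    and "y = (\<lambda>x. \<Sum>k = 0..n div 2. real ((n div 2) choose k) *
           (\<Prod>i < n div 2 - k.
              ((2 * real i + (-1) ^ (n + 1) + 2 * real (n div 2) + 1 - 2 / lam) * a + 2 * c / lam) /
              ((2 * real i + (-1) ^ (n + 1) + 3 - 2 / lam) * b + 2 * d / lam)) *
           rpow x ((real n - 2 * real k) * lam / 2))"
  shows "\<exists>y' y'' :: real \<Rightarrow> real. \<forall>x \<in> solution_domain lam n.
           (y has_real_derivative y' x) (at x within solution_domain lam n) \<and>
           (y' has_real_derivative y'' x) (at x within solution_domain lam n) \<and>
           x\<^sup>2 * (a * rpow x lam + b) * y'' x + x * (c * rpow x lam + d) * y' x +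
             (\<alpha> * rpow x lam + \<beta> * (1 - (-1) ^ n) / 2) * y x = 0"
proof -
  define m where "m = n div 2"
  \<comment> \<open>The parity of \<open>n\<close> as a real number lets both parities share the
    same polynomial identities, with \<open>eps * eps = eps\<close> as the only extra
    relation.\<close>
  define eps :: real where "eps = (if even n then 0 else 1)"
  define num den where "num i = (2 * real i + (-1) ^ (n + 1) + 2 * real m + 1 - 2 / lam) * a + 2 * c / lam"
    and "den i = (2 * real i + (-1) ^ (n + 1) + 3 - 2 / lam) * b + 2 * d / lam" for i :: nat
  define A where "A j = real (m choose j) * (\<Prod>i<j. num i / den i)" for j
  define e where "e j = (2 * real j + eps) * lam / 2" for j :: nat
  define P where "P j = a * (e j * (e j - 1)) + c * e j + \<alpha>" for j
  define Q where "Q j = b * (e j * (e j - 1)) + d * e j + \<beta> * eps" for j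
  have n: "real n = 2 * real m + eps"
    unfolding m_def eps_def by (auto elim!: evenE oddE)
  have sgn: "(-1 :: real) ^ (n + 1) = 2 * eps - 1" by (simp add: eps_def)
  have eps: "eps * eps = eps" "(1 - (-1) ^ n) / 2 = eps" by (auto simp: eps_def)
  have expo: "(real n - 2 * real (m - j)) * lam / 2 = e j" if "j \<le> m" for j
    using that by (simp add: n e_def of_nat_diff)
  \<comment> \<open>By symmetry of the binomial coefficient, the coefficient of the
    \<open>k\<close>-th term depends on \<open>m - k\<close> only; reversing the sum then orders it
    by increasing \<open>j\<close>.\<close>
  have "y x = (\<Sum>k = 0..m. A (m - k) * rpow x ((real n - 2 * real k) * lam / 2))" for x
    unfolding assms(5) A_def num_def den_def m_def[symmetric]
    by (intro sum.cong) (simp_all add: binomial_symmetric[symmetric])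
  also have "\<dots> x = (\<Sum>j\<le>m. A j * rpow x (e j))" for x
    by (subst sum.atLeastAtMost_rev) (simp add: expo atLeast0AtMost del: of_nat_diff)
  finally have y: "y = (\<lambda>x. \<Sum>j\<le>m. A j * rpow x (e j))" by blast

  have step: "A j * P j + A (Suc j) * Q (Suc j) = 0" if "j < m" for j
  proof -
    have num: "lam * num j = (lam * (2 * real j + 2 * eps + 2 * real m) - 2) * a + 2 * c"
      using assms(1) unfolding num_def sgn by (simp add: field_simps)
    \<comment> \<open>As a quadratic in the exponent, \<open>P\<close> has the root
      \<open>e m\<close>. The factor \<open>e j - e m\<close> is
      \<open>- (real m - real j) * lam\<close>, and the cofactor is
      \<open>lam * num j / 2\<close>.\<close>
    have P: "P j = - ((real m - real j) * (lam / 2 * (lam * num j)))"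
      unfolding num P_def assms(2) n e_def by (simp add: field_simps)
    have den: "lam * den j = (lam * (2 * real j + 2 * eps + 2) - 2) * b + 2 * d"
      using assms(1) unfolding den_def sgn by (simp add: field_simps)
    \<comment> \<open>Likewise \<open>Q\<close> has the root \<open>e 0\<close>, with cofactor
      \<open>lam * den j / 2\<close>. The remainder arises because \<open>\<beta> * eps\<close> is
      linear in \<open>eps\<close> while \<open>e 0 * (e 0 - 1)\<close> is quadratic.\<close>
    have "Q (Suc j) - (real j + 1) * (lam / 2 * (lam * den j)) = (eps * eps - eps) * lam\<^sup>2 * b / 4"
      unfolding den Q_def assms(3) e_def by (simp add: field_simps power2_eq_square)
    then have Q: "Q (Suc j) = (real j + 1) * (lam / 2 * (lam * den j))"
      by (simp add: eps(1))
    have den0: "den j \<noteq> 0" using assms(4)[of j] that by (simp add: den_def m_def)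
    \<comment> \<open>The ratio of consecutive binomial coefficients accounts for the factors
      \<open>real m - real j\<close> and \<open>real j + 1\<close> left over from \<open>P\<close>
      and \<open>Q\<close>.\<close>
    have "real (Suc j * (m choose Suc j)) = real ((m - j) * (m choose j))"
      by (metis binomial_absorb_comp binomial_absorption mult.commute)
    then have bin: "(real j + 1) * real (m choose Suc j) = (real m - real j) * real (m choose j)"
      using that by (simp add: of_nat_diff algebra_simps)
    have "A (Suc j) * Q (Suc j) =
        ((real j + 1) * real (m choose Suc j)) * (\<Prod>i<j. num i / den i) * (lam / 2 * (lam * num j))"
      using den0 by (simp add: A_def Q)
    also have "\<dots> = - (A j * P j)" unfolding bin by (simp add: A_def P mult_ac)
    finally show ?thesis by simp
  qed
  have Pm: "P m = 0"
    unfolding P_def assms(2) e_def n by (simp add: field_simps power2_eq_square)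
  have Q0: "Q 0 = 0"
    unfolding Q_def assms(3) e_def by (auto simp: eps_def field_simps)

  define S where "S = solution_domain lam n"
  define y' y'' where "y' x = (\<Sum>j\<le>m. A j * rpow_deriv (e j) x)"
    and "y'' x = (\<Sum>j\<le>m. A j * rpow_deriv2 (e j) x)" for x
  have "(y has_real_derivative y' x) (at x within S) \<and>
      (y' has_real_derivative y'' x) (at x within S) \<and>
      x\<^sup>2 * (a * rpow x lam + b) * y'' x + x * (c * rpow x lam + d) * y' x +
        (\<alpha> * rpow x lam + \<beta> * (1 - (-1) ^ n) / 2) * y x = 0" if "x \<in> S" for x
  proof -
    have lam: "rpow_defined x lam" using that by (simp add: S_def solution_domain_def)
    have ej: "rpow_defined x (e j) \<and> (x = 0 \<longrightarrow> e j = 0 \<or> e j = 1 \<or> e j \<ge> 2)" if "j \<le> m" for j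
    proof -
      have "\<forall>k\<le>m. (let e = (real n - 2 * real k) * lam / 2 in
          rpow_defined x e \<and> (x = 0 \<longrightarrow> e = 0 \<or> e = 1 \<or> e \<ge> 2))"
        using \<open>x \<in> S\<close> unfolding S_def solution_domain_def m_def[symmetric] by blast
      from this[rule_format, of "m - j"] show ?thesis
        unfolding Let_def expo[OF that] by simp
    qed
    then have pos: "x = 0 \<longrightarrow> e j \<ge> 0" if "j \<le> m" for j
      using that by fastforce
    have "(y has_real_derivative y' x) (at x within S)"
      unfolding y y'_def using ej
      by (intro DERIV_sum DERIV_cmult has_field_derivative_at_within[OF has_real_derivative_rpow]) auto
    moreover have "(y' has_real_derivative y'' x) (at x within S)"
      unfolding y'_def[abs_def] y''_def using ej
      by (intro DERIV_sum DERIV_cmult has_field_derivative_at_within[OF has_real_derivative_rpow_deriv]) auto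
    moreover have "x\<^sup>2 * (a * rpow x lam + b) * y'' x + x * (c * rpow x lam + d) * y' x +
        (\<alpha> * rpow x lam + \<beta> * (1 - (-1) ^ n) / 2) * y x = 0"
    proof -
      \<comment> \<open>Pairing each derivative with its power of \<open>x\<close> leaves no
        quotients, so the computation also covers \<open>x = 0\<close>.\<close>
      have y1: "x * y' x = (\<Sum>j\<le>m. A j * (e j * rpow x (e j)))"
        unfolding y'_def sum_distrib_left
        by (intro sum.cong) (simp_all add: mult.left_commute[of x] mult_rpow_deriv pos)
      have y2: "x\<^sup>2 * y'' x = (\<Sum>j\<le>m. A j * (e j * (e j - 1) * rpow x (e j)))"
        unfolding y''_def sum_distrib_left
        by (intro sum.cong) (simp_all add: mult.left_commute[of "x\<^sup>2"] power2_mult_rpow_deriv2 pos)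
      have "x\<^sup>2 * (a * rpow x lam + b) * y'' x + x * (c * rpow x lam + d) * y' x +
          (\<alpha> * rpow x lam + \<beta> * (1 - (-1) ^ n) / 2) * y x =
          (a * rpow x lam + b) * (x\<^sup>2 * y'' x) + (c * rpow x lam + d) * (x * y' x) +
          (\<alpha> * rpow x lam + \<beta> * eps) * y x"
        unfolding eps(2)[symmetric] by (simp add: mult_ac)
      also have "\<dots> = (\<Sum>j\<le>m. A j * (P j * rpow x lam + Q j) * rpow x (e j))"
        unfolding y1 y2 y sum_distrib_left sum.distrib[symmetric] P_def Q_def
        by (intro sum.cong) (simp_all add: algebra_simps)
      also have "\<dots> = 0"
      \<comment> \<open>The shift of exponents by \<open>lam\<close> is legitimate since membership
        in the domain makes the powers with exponents \<open>lam\<close> and \<open>e j\<close> both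
        defined.\<close>
      proof (rule two_term_recurrence_sum_eq_0[where P = P and Q = Q, OF Pm Q0 _ step])
        fix j assume "j < m"
        moreover have "e (Suc j) = lam + e j" by (simp add: e_def field_simps)
        ultimately show "rpow x lam * rpow x (e j) = rpow x (e (Suc j))"
          using rpow_add[OF lam, of "e j"] ej[of j] by simp
      qed
      finally show ?thesis .
    qed
    ultimately show ?thesis by blast
  qed
  then show ?thesis unfolding S_def by blast
qed

end
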